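(* Let $T:W\to W$ be an automorphism in a preadditive category, let $\omega$ be a finite product or coproduct structure on $W$, and let $A=T(\omega,\omega)$ be the matrix of $T$ with respect to $\omega$. If $A$ has acyclic support, then for all $i,j\in\omega$ $$A^{-1}(i,j)=\sum_{p\in\mathbf P_t(i,j)}(-1)^{\ell(p)+1}A[p],$$ where $t$ is the strictly-triangular (off-diagonal) part of $A$, and $\mathbf P_t(i,j)$, $\ell(p)$ and $A[p]$ are as defined in the context.
   Context: A coproduct structure on $W$ is a family $\omega$ of morphisms $f:D(f)\to W$ such that the induced map $\bigoplus_{f\in\omega}D(f)\to W$ is an isomorphism; a product structure is a family of morphisms out of $W$ such that the induced map to the product of their codomains is an isomorphism. A coproduct structure $\omega$ has a unique dual product structure $\{f^\sharp\}_{f\in\omega}$ with $f^\sharp g=\delta_{f,g}$ (identity if $f=g$, zero otherwise), and dually a product structure has a dual coproduct structure; in either case write $f^\flat$ for the morphism into $W$ and $f^\sharp$ for the morphism out of $W$ associated with $f\in\omega$. The matrix of $T$ has entries $T(a,b)=a^\sharp T b^\flat$ for $a,b\in\omega$, and $A^{-1}$ is the matrix of $T^{-1}$. The support of $A$ is $\{(a,b):A(a,b)\neq0\}$; a binary relation on $\omega$ is acyclic if it extends to (is contained in) a partial order on $\omega$. The off-diagonal part $t$ of $A$ is the array with $t(a,b)=A(a,b)$ for $a\ne b$ and $t(a,a)=0$. For a sequence $p=(p_0,\dots,p_m)$ in $\omega$, $m\ge0$, put $\ell(p)=m$ (the last integer on which $p$ is defined), put $t(p)=1$ if $m=0$ and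 $t(p)=t(p_0,p_1)t(p_1,p_2)\cdots t(p_{m-1},p_m)$ if $m>0$, and put $$A[p]=A(p_0,p_0)^{-1}A(p_0,p_1)A(p_1,p_1)^{-1}\cdots A(p_{m-1},p_m)A(p_m,p_m)^{-1}.$$ $\mathbf P_t(i,j)$ is the set of all such sequences $p$ (of all lengths $m\ge0$) with $p_0=i$, $p_m=j$ and $t(p)\neq0$.
   Formalization: The sign is (-1)^{ℓ(p)} instead of (-1)^{ℓ(p)+1}; all diagonal entries A(a,a) are assumed invertible so that A[p] is defined; P_t(i,j) consists of the sequences whose every factor t(p_k,p_{k+1}) is nonzero, instead of those whose composite t(p) is nonzero. *)

theory Defs
  imports "HOL-Algebra.Ring"
begin

text \<open>
  The hom-objects are records of type \<open>ring\<close> only so that the library's additive notation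
  (\<open>\<oplus>\<close>, \<open>\<zero>\<close>, \<open>finsum\<close>, integer multiples \<open>add_pow\<close>) is available.  Only \<open>abelian_group\<close> is
  required of them, so their multiplicative fields are unconstrained and never used.
\<close>

record ('o, 'm) preadd =
  Ob :: "'o set"
  Mor :: "'o \<Rightarrow> 'o \<Rightarrow> 'm ring"
  Ide :: "'o \<Rightarrow> 'm"
  Comp :: "'m \<Rightarrow> 'm \<Rightarrow> 'm" (infixr \<open>\<bullet>\<index>\<close> 75)

locale preadditive_category =
  fixes C :: "('o, 'm) preadd" (structure)
  assumes Mor_abelian_group:
      "\<lbrakk>X \<in> Ob C; Y \<in> Ob C\<rbrakk> \<Longrightarrow> abelian_group (Mor C X Y)"
    and Mor_disjoint:
      "\<lbrakk>X \<in> Ob C; Y \<in> Ob C; X' \<in> Ob C; Y' \<in> Ob C;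
        f \<in> carrier (Mor C X Y); f \<in> carrier (Mor C X' Y')\<rbrakk> \<Longrightarrow> X = X' \<and> Y = Y'"
    and Ide_closed: "X \<in> Ob C \<Longrightarrow> Ide C X \<in> carrier (Mor C X X)"
    and Comp_closed:
      "\<lbrakk>X \<in> Ob C; Y \<in> Ob C; Z \<in> Ob C; f \<in> carrier (Mor C X Y); g \<in> carrier (Mor C Y Z)\<rbrakk>
        \<Longrightarrow> g \<bullet> f \<in> carrier (Mor C X Z)"
    and Comp_assoc:
      "\<lbrakk>X \<in> Ob C; Y \<in> Ob C; Z \<in> Ob C; V \<in> Ob C;
        f \<in> carrier (Mor C X Y); g \<in> carrier (Mor C Y Z); h \<in> carrier (Mor C Z V)\<rbrakk>
        \<Longrightarrow> (h \<bullet> g) \<bullet> f = h \<bullet> (g \<bullet> f)"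
    and Comp_Ide_right:
      "\<lbrakk>X \<in> Ob C; Y \<in> Ob C; f \<in> carrier (Mor C X Y)\<rbrakk> \<Longrightarrow> f \<bullet> Ide C X = f"
    and Comp_Ide_left:
      "\<lbrakk>X \<in> Ob C; Y \<in> Ob C; f \<in> carrier (Mor C X Y)\<rbrakk> \<Longrightarrow> Ide C Y \<bullet> f = f"
    and Comp_add_right:
      "\<lbrakk>X \<in> Ob C; Y \<in> Ob C; Z \<in> Ob C;
        f \<in> carrier (Mor C X Y); f' \<in> carrier (Mor C X Y); g \<in> carrier (Mor C Y Z)\<rbrakk>
        \<Longrightarrow> g \<bullet> (f \<oplus>\<^bsub>Mor C X Y\<^esub> f') = (g \<bullet> f) \<oplus>\<^bsub>Mor C X Z\<^esub> (g \<bullet> f')"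
    and Comp_add_left:
      "\<lbrakk>X \<in> Ob C; Y \<in> Ob C; Z \<in> Ob C;
        f \<in> carrier (Mor C X Y); g \<in> carrier (Mor C Y Z); g' \<in> carrier (Mor C Y Z)\<rbrakk>
        \<Longrightarrow> (g \<oplus>\<^bsub>Mor C Y Z\<^esub> g') \<bullet> f = (g \<bullet> f) \<oplus>\<^bsub>Mor C X Z\<^esub> (g' \<bullet> f)"

definition inverse_pair :: "('o, 'm) preadd \<Rightarrow> 'o \<Rightarrow> 'o \<Rightarrow> 'm \<Rightarrow> 'm \<Rightarrow> bool" where
  "inverse_pair C X Y f g \<longleftrightarrow>
     f \<in> carrier (Mor C X Y) \<and> g \<in> carrier (Mor C Y X) \<and>
     g \<bullet>\<^bsub>C\<^esub> f = Ide C X \<and> f \<bullet>\<^bsub>C\<^esub> g = Ide C Y"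

definition iso_mor :: "('o, 'm) preadd \<Rightarrow> 'o \<Rightarrow> 'o \<Rightarrow> 'm \<Rightarrow> bool" where
  "iso_mor C X Y f \<longleftrightarrow> (\<exists>g. inverse_pair C X Y f g)"

definition inv_mor :: "('o, 'm) preadd \<Rightarrow> 'o \<Rightarrow> 'o \<Rightarrow> 'm \<Rightarrow> 'm" where
  "inv_mor C X Y f = (THE g. inverse_pair C X Y f g)"

text \<open>
  Families are indexed by a set \<open>I\<close>; indexing a set of morphisms by itself is the case where
  \<open>\<omega>\<close> is the identity function.  The object \<open>D a\<close> is the domain (for coproducts) or the codomain
  (for products) of the member with index \<open>a\<close>.
\<close>

definition is_coproduct ::
  "('o, 'm) preadd \<Rightarrow> 'i set \<Rightarrow> ('i \<Rightarrow> 'o) \<Rightarrow> 'o \<Rightarrow> ('i \<Rightarrow> 'm) \<Rightarrow> bool" where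
  "is_coproduct C I D S \<iota> \<longleftrightarrow>
     S \<in> Ob C \<and> (\<forall>a\<in>I. \<iota> a \<in> carrier (Mor C (D a) S)) \<and>
     (\<forall>Y\<in>Ob C. \<forall>g. (\<forall>a\<in>I. g a \<in> carrier (Mor C (D a) Y)) \<longrightarrow>
        (\<exists>!h. h \<in> carrier (Mor C S Y) \<and> (\<forall>a\<in>I. h \<bullet>\<^bsub>C\<^esub> \<iota> a = g a)))"

definition is_product ::
  "('o, 'm) preadd \<Rightarrow> 'i set \<Rightarrow> ('i \<Rightarrow> 'o) \<Rightarrow> 'o \<Rightarrow> ('i \<Rightarrow> 'm) \<Rightarrow> bool" where
  "is_product C I D P \<pi> \<longleftrightarrow>
     P \<in> Ob C \<and> (\<forall>a\<in>I. \<pi> a \<in> carrier (Mor C P (D a))) \<and>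
     (\<forall>Y\<in>Ob C. \<forall>g. (\<forall>a\<in>I. g a \<in> carrier (Mor C Y (D a))) \<longrightarrow>
        (\<exists>!h. h \<in> carrier (Mor C Y P) \<and> (\<forall>a\<in>I. \<pi> a \<bullet>\<^bsub>C\<^esub> h = g a)))"

text \<open>
  A preadditive category need not have direct sums, so the existence of the direct sum (product)
  that the induced map starts from (ends in) is part of the following two notions.
\<close>

definition coproduct_structure ::
  "('o, 'm) preadd \<Rightarrow> 'i set \<Rightarrow> ('i \<Rightarrow> 'o) \<Rightarrow> 'o \<Rightarrow> ('i \<Rightarrow> 'm) \<Rightarrow> bool" where
  "coproduct_structure C I D W \<omega> \<longleftrightarrow>
     W \<in> Ob C \<and> (\<forall>a\<in>I. D a \<in> Ob C \<and> \<omega> a \<in> carrier (Mor C (D a) W)) \<and>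
     (\<exists>S \<iota>. is_coproduct C I D S \<iota> \<and>
        (\<exists>h. iso_mor C S W h \<and> (\<forall>a\<in>I. h \<bullet>\<^bsub>C\<^esub> \<iota> a = \<omega> a)))"

definition product_structure ::
  "('o, 'm) preadd \<Rightarrow> 'i set \<Rightarrow> ('i \<Rightarrow> 'o) \<Rightarrow> 'o \<Rightarrow> ('i \<Rightarrow> 'm) \<Rightarrow> bool" where
  "product_structure C I D W \<omega> \<longleftrightarrow>
     W \<in> Ob C \<and> (\<forall>a\<in>I. D a \<in> Ob C \<and> \<omega> a \<in> carrier (Mor C W (D a))) \<and>
     (\<exists>P \<pi>. is_product C I D P \<pi> \<and>
        (\<exists>h. iso_mor C W P h \<and> (\<forall>a\<in>I. \<pi> a \<bullet>\<^bsub>C\<^esub> h = \<omega> a)))"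

definition delta :: "('o, 'm) preadd \<Rightarrow> ('i \<Rightarrow> 'o) \<Rightarrow> 'i \<Rightarrow> 'i \<Rightarrow> 'm" where
  "delta C D a b = (if a = b then Ide C (D a) else \<zero>\<^bsub>Mor C (D b) (D a)\<^esub>)"

definition dual_product ::
  "('o, 'm) preadd \<Rightarrow> 'i set \<Rightarrow> ('i \<Rightarrow> 'o) \<Rightarrow> 'o \<Rightarrow> ('i \<Rightarrow> 'm) \<Rightarrow> 'i \<Rightarrow> 'm" where
  "dual_product C I D W \<omega> a =
     (THE f. f \<in> carrier (Mor C W (D a)) \<and> (\<forall>b\<in>I. f \<bullet>\<^bsub>C\<^esub> \<omega> b = delta C D a b))"

definition dual_coproduct ::
  "('o, 'm) preadd \<Rightarrow> 'i set \<Rightarrow> ('i \<Rightarrow> 'o) \<Rightarrow> 'o \<Rightarrow> ('i \<Rightarrow> 'm) \<Rightarrow> 'i \<Rightarrow> 'm" where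
  "dual_coproduct C I D W \<omega> b =
     (THE f. f \<in> carrier (Mor C (D b) W) \<and> (\<forall>a\<in>I. \<omega> a \<bullet>\<^bsub>C\<^esub> f = delta C D a b))"

text \<open>
  A one-member family can be a product and a coproduct structure at the same time, with different
  flats and sharps, so these are related to \<open>\<omega>\<close> by a predicate rather than computed from \<open>\<omega>\<close>.
\<close>

definition structure_with_dual ::
  "('o, 'm) preadd \<Rightarrow> 'i set \<Rightarrow> ('i \<Rightarrow> 'o) \<Rightarrow> 'o \<Rightarrow> ('i \<Rightarrow> 'm) \<Rightarrow> ('i \<Rightarrow> 'm) \<Rightarrow> ('i \<Rightarrow> 'm) \<Rightarrow> bool"
  where
  "structure_with_dual C I D W \<omega> flat sharp \<longleftrightarrow>
     (coproduct_structure C I D W \<omega> \<and> flat = \<omega> \<and> sharp = dual_product C I D W \<omega>) \<or>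
     (product_structure C I D W \<omega> \<and> sharp = \<omega> \<and> flat = dual_coproduct C I D W \<omega>)"

definition matrix_of ::
  "('o, 'm) preadd \<Rightarrow> ('i \<Rightarrow> 'm) \<Rightarrow> ('i \<Rightarrow> 'm) \<Rightarrow> 'm \<Rightarrow> 'i \<Rightarrow> 'i \<Rightarrow> 'm" where
  "matrix_of C flat sharp T a b = sharp a \<bullet>\<^bsub>C\<^esub> T \<bullet>\<^bsub>C\<^esub> flat b"

definition support ::
  "('o, 'm) preadd \<Rightarrow> 'i set \<Rightarrow> ('i \<Rightarrow> 'o) \<Rightarrow> ('i \<Rightarrow> 'i \<Rightarrow> 'm) \<Rightarrow> 'i rel" where
  "support C I D A = {(a, b) \<in> I \<times> I. A a b \<noteq> \<zero>\<^bsub>Mor C (D b) (D a)\<^esub>}"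

text \<open>Unlike \<open>acyclic\<close> of the library, this permits loops \<open>(a, a)\<close>.\<close>

definition acyclic_on :: "'i set \<Rightarrow> 'i rel \<Rightarrow> bool" where
  "acyclic_on I R \<longleftrightarrow> (\<exists>P. partial_order_on I P \<and> R \<subseteq> P)"

definition off_diagonal ::
  "('o, 'm) preadd \<Rightarrow> ('i \<Rightarrow> 'o) \<Rightarrow> ('i \<Rightarrow> 'i \<Rightarrow> 'm) \<Rightarrow> 'i \<Rightarrow> 'i \<Rightarrow> 'm" where
  "off_diagonal C D A a b = (if a = b then \<zero>\<^bsub>Mor C (D a) (D a)\<^esub> else A a b)"

text \<open>
  A sequence \<open>(p\<^sub>0, \<dots>, p\<^sub>m)\<close> is a nonempty list of length \<open>m + 1\<close>, and \<open>last_index\<close> is \<open>m\<close>.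
\<close>

definition last_index :: "'i list \<Rightarrow> nat" where
  "last_index p = length p - 1"

text \<open>
  The sequences from \<open>i\<close> to \<open>j\<close> along which no factor \<open>t(p\<^sub>k, p\<^sub>k\<^sub>+\<^sub>1)\<close> vanishes.  The composite of
  these factors may nevertheless be zero: such a sequence still contributes to the inverse, because
  \<open>path_product\<close> below interleaves the factors with inverses of diagonal entries.
\<close>

definition paths ::
  "('o, 'm) preadd \<Rightarrow> 'i set \<Rightarrow> ('i \<Rightarrow> 'o) \<Rightarrow> ('i \<Rightarrow> 'i \<Rightarrow> 'm) \<Rightarrow> 'i \<Rightarrow> 'i \<Rightarrow> 'i list set" where
  "paths C I D t i j =
     {p. p \<noteq> [] \<and> set p \<subseteq> I \<and> hd p = i \<and> last p = j \<and>
         (\<forall>k < last_index p.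
            t (p ! k) (p ! Suc k) \<noteq> \<zero>\<^bsub>Mor C (D (p ! Suc k)) (D (p ! k))\<^esub>)}"

fun path_product ::
  "('o, 'm) preadd \<Rightarrow> ('i \<Rightarrow> 'o) \<Rightarrow> ('i \<Rightarrow> 'i \<Rightarrow> 'm) \<Rightarrow> 'i list \<Rightarrow> 'm" where
  "path_product C D A [a] = inv_mor C (D a) (D a) (A a a)"
| "path_product C D A (a # b # p) =
     inv_mor C (D a) (D a) (A a a) \<bullet>\<^bsub>C\<^esub> A a b \<bullet>\<^bsub>C\<^esub> path_product C D A (b # p)"

end

theory Submission
  imports Defs
begin

text \<open>The equation AM = 1 is used rather than MA = 1 because \<open>A i i\<close> then stands
  directly to the left of M(i,j): composing with its inverse on the left isolates M(i,j), and each
  unrolling of the recursion adds a factor at the front of A[p], just as \<open>Cons\<close> adds a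
  vertex at the front of a list. The entries lie in different hom-groups, so the argument runs entry
  by entry, each sum being taken in the group of morphisms from \<open>D j\<close> to
  \<open>D i\<close>. A \<open>finsum\<close> over an infinite set is zero by convention, so the
  path sets must be shown finite together with the formula. The identity for the sum of flats after
  sharps is obtained from the universal property of a coproduct; products are reduced to that case
  by reversing all arrows.\<close>

text \<open>
  The flats and sharps of a finite structure satisfy $\sum_k k^\flat k^\sharp = 1_W$, so the matrix
  $M$ of $T^{-1}$ satisfies $A M = 1$.  Solving row $i$ of this equation for $M(i,j)$ gives
  \[ M(i,j) = A(i,i)^{-1} \delta_{i,j}
       - \sum_{k \ne i} A(i,i)^{-1} A(i,k) M(k,j). \]
  The sum over paths obeys the same recursion, by splitting off the first step of a path.  Only
  indices $k$ strictly above $i$ contribute, so the recursion determines its solution.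
\<close>

section \<open>Composition in a preadditive category\<close>

definition opposite :: "('o, 'm) preadd \<Rightarrow> ('o, 'm) preadd" where
  "opposite C = \<lparr>Ob = Ob C, Mor = (\<lambda>X Y. Mor C Y X), Ide = Ide C, Comp = (\<lambda>g f. f \<bullet>\<^bsub>C\<^esub> g)\<rparr>"

lemma opposite_simps [simp]:
  "Ob (opposite C) = Ob C"
  "Mor (opposite C) X Y = Mor C Y X"
  "Ide (opposite C) = Ide C"
  "g \<bullet>\<^bsub>opposite C\<^esub> f = f \<bullet>\<^bsub>C\<^esub> g"
  by (simp_all add: opposite_def)

text \<open>A hom-group between different objects has no unit that could carry a sign, so signs are
  integer multiples by powers of -1. Each further step of a path negates.\<close>

lemma (in abelian_group) add_pow_minus_one_Suc:
  assumes "x \<in> carrier G"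
  shows "[((- 1 :: int) ^ Suc n)] \<cdot> x = \<ominus> ([((- 1 :: int) ^ n)] \<cdot> x)"
  using add.int_pow_neg[OF assms] by simp

context preadditive_category
begin

lemma preadditive_opposite: "preadditive_category (opposite C)"
proof (rule preadditive_category.intro, goal_cases)
  \<comment> \<open>This is disjointness of hom-sets, where reversing arrows delivers the two
    equations in the other order.\<close>
  case 2
  then show ?case
    unfolding opposite_simps by (meson Mor_disjoint)
qed (auto simp: Mor_abelian_group Ide_closed Comp_closed Comp_assoc Comp_Ide_right
  Comp_Ide_left Comp_add_right Comp_add_left)

lemma Comp_zero_right:
  assumes "X \<in> Ob C" "Y \<in> Ob C" "Z \<in> Ob C" "g \<in> carrier (Mor C Y Z)"
  shows "g \<bullet> \<zero>\<^bsub>Mor C X Y\<^esub> = \<zero>\<^bsub>Mor C X Z\<^esub>"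
proof -
  interpret XY: abelian_group "Mor C X Y" using assms by (simp add: Mor_abelian_group)
  interpret XZ: abelian_group "Mor C X Z" using assms by (simp add: Mor_abelian_group)
  have c: "g \<bullet> \<zero>\<^bsub>Mor C X Y\<^esub> \<in> carrier (Mor C X Z)"
    using assms Comp_closed by blast
  have "g \<bullet> \<zero>\<^bsub>Mor C X Y\<^esub> \<oplus>\<^bsub>Mor C X Z\<^esub> g \<bullet> \<zero>\<^bsub>Mor C X Y\<^esub> = g \<bullet> \<zero>\<^bsub>Mor C X Y\<^esub>"
    using Comp_add_right[of X Y Z "\<zero>\<^bsub>Mor C X Y\<^esub>" "\<zero>\<^bsub>Mor C X Y\<^esub>" g] assms by simp
  then show ?thesis using c XZ.add.r_cancel_one by simp
qed

lemma Comp_minus_right: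
  assumes "X \<in> Ob C" "Y \<in> Ob C" "Z \<in> Ob C" "f \<in> carrier (Mor C X Y)" "g \<in> carrier (Mor C Y Z)"
  shows "g \<bullet> (\<ominus>\<^bsub>Mor C X Y\<^esub> f) = \<ominus>\<^bsub>Mor C X Z\<^esub> (g \<bullet> f)"
proof -
  interpret XY: abelian_group "Mor C X Y" using assms by (simp add: Mor_abelian_group)
  interpret XZ: abelian_group "Mor C X Z" using assms by (simp add: Mor_abelian_group)
  have c: "g \<bullet> f \<in> carrier (Mor C X Z)" "g \<bullet> (\<ominus>\<^bsub>Mor C X Y\<^esub> f) \<in> carrier (Mor C X Z)"
    using assms Comp_closed XY.a_inv_closed by blast+
  have "g \<bullet> (\<ominus>\<^bsub>Mor C X Y\<^esub> f) \<oplus>\<^bsub>Mor C X Z\<^esub> g \<bullet> f = \<zero>\<^bsub>Mor C X Z\<^esub>"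
    using Comp_add_right[of X Y Z "\<ominus>\<^bsub>Mor C X Y\<^esub> f" f g] assms
    by (simp add: XY.l_neg Comp_zero_right)
  then show ?thesis using c XZ.minus_equality by simp
qed

lemma Comp_sign_right:
  assumes "X \<in> Ob C" "Y \<in> Ob C" "Z \<in> Ob C" "f \<in> carrier (Mor C X Y)" "g \<in> carrier (Mor C Y Z)"
  shows "g \<bullet> ([((- 1 :: int) ^ n)] \<cdot>\<^bsub>Mor C X Y\<^esub> f) = [((- 1 :: int) ^ n)] \<cdot>\<^bsub>Mor C X Z\<^esub> (g \<bullet> f)"
proof -
  interpret XY: abelian_group "Mor C X Y" using assms by (simp add: Mor_abelian_group)
  interpret XZ: abelian_group "Mor C X Z" using assms by (simp add: Mor_abelian_group)
  have c: "g \<bullet> f \<in> carrier (Mor C X Z)"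
    using assms Comp_closed by blast
  show ?thesis
  proof (induction n)
    case 0
    then show ?case using assms c XY.add.int_pow_1 XZ.add.int_pow_1 by simp
  next
    case (Suc n)
    show ?case
      unfolding XY.add_pow_minus_one_Suc[OF assms(4)] XZ.add_pow_minus_one_Suc[OF c] Suc[symmetric]
      by (rule Comp_minus_right) (use assms in auto)
  qed
qed

lemma Comp_finsum_right:
  assumes "X \<in> Ob C" "Y \<in> Ob C" "Z \<in> Ob C" "g \<in> carrier (Mor C Y Z)" "finite S"
    and "\<And>k. k \<in> S \<Longrightarrow> f k \<in> carrier (Mor C X Y)"
  shows "g \<bullet> (\<Oplus>\<^bsub>Mor C X Y\<^esub>k\<in>S. f k) = (\<Oplus>\<^bsub>Mor C X Z\<^esub>k\<in>S. g \<bullet> f k)"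
proof -
  interpret XY: abelian_group "Mor C X Y" using assms by (simp add: Mor_abelian_group)
  interpret XZ: abelian_group "Mor C X Z" using assms by (simp add: Mor_abelian_group)
  show ?thesis
    using assms(5,6)
  proof (induction S rule: finite_induct)
    case empty
    then show ?case using assms by (simp add: Comp_zero_right)
  next
    case (insert x F)
    have "f \<in> F \<rightarrow> carrier (Mor C X Y)" "f x \<in> carrier (Mor C X Y)"
      using insert.prems by auto
    moreover have "(\<lambda>k. g \<bullet> f k) \<in> F \<rightarrow> carrier (Mor C X Z)" "g \<bullet> f x \<in> carrier (Mor C X Z)"
      using insert.prems assms(1-4) Comp_closed by auto
    ultimately show ?case
      using insert assms(1-4) by (simp add: Comp_add_right)
  qed
qed

lemma Comp_finsum_left:
  assumes "X \<in> Ob C" "Y \<in> Ob C" "Z \<in> Ob C" "f \<in> carrier (Mor C X Y)" "finite S"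
    and "\<And>k. k \<in> S \<Longrightarrow> g k \<in> carrier (Mor C Y Z)"
  shows "(\<Oplus>\<^bsub>Mor C Y Z\<^esub>k\<in>S. g k) \<bullet> f = (\<Oplus>\<^bsub>Mor C X Z\<^esub>k\<in>S. g k \<bullet> f)"
  using preadditive_category.Comp_finsum_right[OF preadditive_opposite, of Z Y X f S g] assms
  by simp

text \<open>Uniqueness of two-sided inverses makes the description in \<open>inv_mor\<close> denote
  an actual inverse.\<close>

lemma inverse_pair_inv_mor:
  assumes "X \<in> Ob C" "Y \<in> Ob C" "iso_mor C X Y f"
  shows "inverse_pair C X Y f (inv_mor C X Y f)"
proof -
  obtain g where g: "inverse_pair C X Y f g"
    using assms unfolding iso_mor_def by blast
  have "h = g" if "inverse_pair C X Y f h" for h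
  proof -
    have "h = h \<bullet> (f \<bullet> g)"
      using g that assms Comp_Ide_right[of Y X h] by (simp add: inverse_pair_def)
    also have "\<dots> = (h \<bullet> f) \<bullet> g"
      using g that assms Comp_assoc[of Y X Y X g f h] by (simp add: inverse_pair_def)
    also have "\<dots> = g"
      using g that assms Comp_Ide_left[of Y X g] by (simp add: inverse_pair_def)
    finally show ?thesis .
  qed
  with g show ?thesis
    unfolding inv_mor_def by (rule theI)
qed

end

section \<open>Structures and their duals\<close>

text \<open>The common form to which both kinds of structure are reduced. It is self-dual: in the
  opposite category the same equations hold with flats and sharps exchanged.\<close>

locale finite_biproduct = preadditive_category C
  for C :: "('o, 'm) preadd" (structure) +
  fixes I :: "'i set" and D :: "'i \<Rightarrow> 'o" and W :: 'o and flat sharp :: "'i \<Rightarrow> 'm"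
  assumes finite_I: "finite I"
    and W_Ob: "W \<in> Ob C"
    and D_Ob: "a \<in> I \<Longrightarrow> D a \<in> Ob C"
    and flat_closed: "a \<in> I \<Longrightarrow> flat a \<in> carrier (Mor C (D a) W)"
    and sharp_closed: "a \<in> I \<Longrightarrow> sharp a \<in> carrier (Mor C W (D a))"
    and sharp_flat: "a \<in> I \<Longrightarrow> b \<in> I \<Longrightarrow> sharp a \<bullet> flat b = delta C D a b"
    and sum_flat_sharp: "(\<Oplus>\<^bsub>Mor C W W\<^esub>k\<in>I. flat k \<bullet> sharp k) = Ide C W"

context preadditive_category
begin

text \<open>The universal property of the chosen direct sum \<open>S\<close> is carried to
  \<open>W\<close> along the isomorphism \<open>u\<close>, so \<open>W\<close> is itself a
  coproduct. Its existence half supplies the sharps, its uniqueness half the identity for their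
  sum.\<close>

lemma coproduct_structure_universal:
  assumes "coproduct_structure C I D W \<omega>" "Y \<in> Ob C"
    and g: "\<And>a. a \<in> I \<Longrightarrow> g a \<in> carrier (Mor C (D a) Y)"
  shows "\<exists>!h. h \<in> carrier (Mor C W Y) \<and> (\<forall>a\<in>I. h \<bullet> \<omega> a = g a)"
proof -
  obtain S \<iota> u v where W: "W \<in> Ob C" and D: "\<And>a. a \<in> I \<Longrightarrow> D a \<in> Ob C"
    and S: "is_coproduct C I D S \<iota>" and uv: "inverse_pair C S W u v"
    and \<omega>: "\<And>a. a \<in> I \<Longrightarrow> u \<bullet> \<iota> a = \<omega> a"
    using assms(1) unfolding coproduct_structure_def iso_mor_def by blast
  have SO: "S \<in> Ob C" and \<iota>: "\<And>a. a \<in> I \<Longrightarrow> \<iota> a \<in> carrier (Mor C (D a) S)"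
    using S unfolding is_coproduct_def by blast+
  have u: "u \<in> carrier (Mor C S W)" and v: "v \<in> carrier (Mor C W S)"
    and vu: "v \<bullet> u = Ide C S" and uv1: "u \<bullet> v = Ide C W"
    using uv unfolding inverse_pair_def by blast+
  have ex1: "\<exists>!h. h \<in> carrier (Mor C S Y) \<and> (\<forall>a\<in>I. h \<bullet> \<iota> a = g a)"
    using S assms(2) g unfolding is_coproduct_def by blast
  then obtain h where h: "h \<in> carrier (Mor C S Y)" "\<And>a. a \<in> I \<Longrightarrow> h \<bullet> \<iota> a = g a"
    by blast
  have v\<omega>: "v \<bullet> \<omega> a = \<iota> a" if "a \<in> I" for a
  proof -
    have "v \<bullet> \<omega> a = (v \<bullet> u) \<bullet> \<iota> a"
      using Comp_assoc[of "D a" S W S "\<iota> a" u v] D W SO \<iota> u v \<omega> that by simp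
    then show ?thesis using vu Comp_Ide_left[of "D a" S "\<iota> a"] D SO \<iota> that by simp
  qed
  have \<omega>c: "\<omega> a \<in> carrier (Mor C (D a) W)" if "a \<in> I" for a
    using assms(1) that unfolding coproduct_structure_def by blast
  show ?thesis
  proof (rule ex1I[of _ "h \<bullet> v"])
    have "(h \<bullet> v) \<bullet> \<omega> a = g a" if "a \<in> I" for a
      using Comp_assoc[of "D a" W S Y "\<omega> a" v h] W SO D assms(2) h v v\<omega> \<omega>c that by simp
    then show "h \<bullet> v \<in> carrier (Mor C W Y) \<and> (\<forall>a\<in>I. (h \<bullet> v) \<bullet> \<omega> a = g a)"
      using Comp_closed[of W S Y v h] W SO assms(2) h v by simp
  next
    fix k assume k: "k \<in> carrier (Mor C W Y) \<and> (\<forall>a\<in>I. k \<bullet> \<omega> a = g a)"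
    \<comment> \<open>A competitor \<open>k\<close> on \<open>W\<close> is pulled back to
      \<open>S\<close>, where uniqueness is known, and recovered by composing with
      \<open>v\<close>.\<close>
    have "k \<bullet> u \<in> carrier (Mor C S Y)"
      using Comp_closed[of S W Y u k] W SO assms(2) k u by simp
    moreover have "(k \<bullet> u) \<bullet> \<iota> a = g a" if "a \<in> I" for a
      using Comp_assoc[of "D a" S W Y "\<iota> a" u k] W SO D assms(2) k u \<omega> \<iota> that by simp
    ultimately have "k \<bullet> u = h" using ex1 h by blast
    then have "h \<bullet> v = k \<bullet> (u \<bullet> v)"
      using Comp_assoc[of W S W Y v u k] W SO assms(2) k u v by simp
    then show "k = h \<bullet> v"
      using uv1 Comp_Ide_right[of W Y k] W assms(2) k by simp
  qed
qed

lemma delta_closed: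
  assumes "D a \<in> Ob C" "D b \<in> Ob C"
  shows "delta C D a b \<in> carrier (Mor C (D b) (D a))"
proof -
  interpret abelian_group "Mor C (D b) (D a)" using assms by (simp add: Mor_abelian_group)
  show ?thesis using assms Ide_closed by (simp add: delta_def)
qed

lemma finsum_Comp_delta:
  assumes "\<And>a. a \<in> I \<Longrightarrow> D a \<in> Ob C" "Y \<in> Ob C" "finite I" "b \<in> I"
    and f: "\<And>a. a \<in> I \<Longrightarrow> f a \<in> carrier (Mor C (D a) Y)"
  shows "(\<Oplus>\<^bsub>Mor C (D b) Y\<^esub>k\<in>I. f k \<bullet> delta C D k b) = f b"
proof -
  interpret abelian_group "Mor C (D b) Y" using assms by (simp add: Mor_abelian_group)
  have "(\<Oplus>\<^bsub>Mor C (D b) Y\<^esub>k\<in>I. f k \<bullet> delta C D k b)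
      = (\<Oplus>\<^bsub>Mor C (D b) Y\<^esub>k\<in>I. if b = k then f b else \<zero>\<^bsub>Mor C (D b) Y\<^esub>)"
    by (rule finsum_cong')
      (use assms in \<open>auto simp: delta_def Comp_Ide_right Comp_zero_right\<close>)
  also have "\<dots> = f b"
    by (rule finsum_singleton[of b I "\<lambda>_. f b"]) (use assms in auto)
  finally show ?thesis .
qed

text \<open>The universal property with target \<open>D a\<close> and the family
  \<open>delta C D a\<close> shows that the description defining the sharp of \<open>a\<close> has a
  unique solution. The sum \<open>?e\<close> and the identity of \<open>W\<close> agree after
  composition with every \<open>\<omega> b\<close>, hence are equal by uniqueness with target
  \<open>W\<close>.\<close>

lemma coproduct_structure_biproduct:
  assumes "coproduct_structure C I D W \<omega>" "finite I"
  shows "finite_biproduct C I D W \<omega> (dual_product C I D W \<omega>)"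
proof -
  define sharp where "sharp = dual_product C I D W \<omega>"
  have W: "W \<in> Ob C" and D: "\<And>a. a \<in> I \<Longrightarrow> D a \<in> Ob C"
    and \<omega>: "\<And>a. a \<in> I \<Longrightarrow> \<omega> a \<in> carrier (Mor C (D a) W)"
    using assms(1) unfolding coproduct_structure_def by blast+
  have sharp: "sharp a \<in> carrier (Mor C W (D a)) \<and> (\<forall>b\<in>I. sharp a \<bullet> \<omega> b = delta C D a b)"
    if "a \<in> I" for a
    unfolding sharp_def dual_product_def
    by (rule theI', rule coproduct_structure_universal[OF assms(1)])
      (use D that in \<open>auto intro: delta_closed\<close>)
  let ?e = "\<Oplus>\<^bsub>Mor C W W\<^esub>k\<in>I. \<omega> k \<bullet> sharp k"
  interpret WW: abelian_group "Mor C W W" using W by (simp add: Mor_abelian_group)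
  have term_closed: "\<omega> k \<bullet> sharp k \<in> carrier (Mor C W W)" if "k \<in> I" for k
    using Comp_closed[of W "D k" W] W D \<omega> sharp that by blast
  have e: "?e \<in> carrier (Mor C W W)"
    using term_closed by (intro WW.finsum_closed) auto
  have "?e \<bullet> \<omega> b = \<omega> b" if b: "b \<in> I" for b
  proof -
    interpret bW: abelian_group "Mor C (D b) W" using W D b by (simp add: Mor_abelian_group)
    have "?e \<bullet> \<omega> b = (\<Oplus>\<^bsub>Mor C (D b) W\<^esub>k\<in>I. (\<omega> k \<bullet> sharp k) \<bullet> \<omega> b)"
      by (rule Comp_finsum_left) (use W D b \<omega> assms(2) term_closed in auto)
    also have "\<dots> = (\<Oplus>\<^bsub>Mor C (D b) W\<^esub>k\<in>I. \<omega> k \<bullet> delta C D k b)"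
    proof (rule bW.finsum_cong')
      show "(\<lambda>k. \<omega> k \<bullet> delta C D k b) \<in> I \<rightarrow> carrier (Mor C (D b) W)"
        using Comp_closed[OF D[OF b] D W delta_closed[of D, OF D D[OF b]] \<omega>] by simp
      show "(\<omega> k \<bullet> sharp k) \<bullet> \<omega> b = \<omega> k \<bullet> delta C D k b" if "k \<in> I" for k
        using Comp_assoc[of "D b" W "D k" W "\<omega> b" "sharp k" "\<omega> k"] W D b \<omega> sharp that by simp
    qed simp
    also have "\<dots> = \<omega> b"
      by (rule finsum_Comp_delta) (use W D b \<omega> assms(2) in auto)
    finally show ?thesis .
  qed
  moreover have "Ide C W \<bullet> \<omega> b = \<omega> b" if "b \<in> I" for b
    using Comp_Ide_left[of "D b" W "\<omega> b"] W D \<omega> that by simp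
  ultimately have "?e = Ide C W"
    using coproduct_structure_universal[of I D W \<omega> W \<omega>, OF assms(1) W \<omega>] e Ide_closed[OF W]
    by blast
  then show ?thesis
    unfolding sharp_def[symmetric]
    by unfold_locales (use assms(2) W D \<omega> sharp in auto)
qed

text \<open>The comparison map runs from \<open>W\<close> to the product, but from the coproduct to
  \<open>W\<close>. Reversing arrows matches the two directions, since being an isomorphism can be
  read from either end.\<close>

lemma product_structure_opposite:
  "product_structure C I D W \<omega> \<longleftrightarrow> coproduct_structure (opposite C) I D W \<omega>"
proof -
  have "inverse_pair (opposite C) P W h = inverse_pair C W P h" for P h
    by (auto simp: fun_eq_iff inverse_pair_def)
  then show ?thesis
    unfolding product_structure_def coproduct_structure_def is_product_def is_coproduct_def
      iso_mor_def by simp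
qed

lemma delta_opposite: "delta (opposite C) D a b = delta C D b a"
  by (auto simp: delta_def)

text \<open>The flats of a product structure are, by definition, the sharps of the same family seen
  as a coproduct structure in the opposite category. The biproduct equations obtained there are read
  back with the two roles exchanged.\<close>

lemma product_structure_biproduct:
  assumes "product_structure C I D W \<omega>" "finite I"
  shows "finite_biproduct C I D W (dual_coproduct C I D W \<omega>) \<omega>"
proof -
  have "dual_coproduct C I D W \<omega> = dual_product (opposite C) I D W \<omega>"
    by (simp add: fun_eq_iff dual_coproduct_def dual_product_def delta_opposite)
  moreover have "finite_biproduct (opposite C) I D W \<omega> (dual_product (opposite C) I D W \<omega>)"
    using assms product_structure_opposite
    by (intro preadditive_category.coproduct_structure_biproduct preadditive_opposite) auto
  ultimately interpret op: finite_biproduct "opposite C" I D W \<omega> "dual_coproduct C I D W \<omega>"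
    by simp
  show ?thesis
    using op.finite_I op.W_Ob op.D_Ob op.flat_closed op.sharp_closed op.sharp_flat op.sum_flat_sharp
    by unfold_locales (simp_all add: delta_opposite)
qed

lemma structure_with_dual_biproduct:
  assumes "structure_with_dual C I D W \<omega> flat sharp" "finite I"
  shows "finite_biproduct C I D W flat sharp"
  using assms coproduct_structure_biproduct product_structure_biproduct
  unfolding structure_with_dual_def by blast

end

section \<open>Matrices\<close>

context finite_biproduct
begin

lemma matrix_of_closed:
  assumes "T \<in> carrier (Mor C W W)" "a \<in> I" "b \<in> I"
  shows "matrix_of C flat sharp T a b \<in> carrier (Mor C (D b) (D a))"
  unfolding matrix_of_def
  using assms W_Ob D_Ob flat_closed sharp_closed
  by (intro Comp_closed[of "D b" W "D a"] Comp_closed[of "D b" W W]) auto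

text \<open>Insert \<open>sum_flat_sharp\<close> between \<open>T\<close> and \<open>S\<close> and
  distribute composition over the sum.\<close>

lemma matrix_of_mult:
  assumes T: "T \<in> carrier (Mor C W W)" and S: "S \<in> carrier (Mor C W W)" and i: "i \<in> I" and j: "j \<in> I"
  shows "(\<Oplus>\<^bsub>Mor C (D j) (D i)\<^esub>k\<in>I. matrix_of C flat sharp T i k \<bullet> matrix_of C flat sharp S k j)
    = matrix_of C flat sharp (T \<bullet> S) i j"
proof -
  note Obs = W_Ob D_Ob[OF i] D_Ob[OF j]
  define u where "u = sharp i \<bullet> T"
  define v where "v = S \<bullet> flat j"
  have u: "u \<in> carrier (Mor C W (D i))" and v: "v \<in> carrier (Mor C (D j) W)"
    unfolding u_def v_def using Comp_closed Obs T S sharp_closed[OF i] flat_closed[OF j] by blast+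
  interpret ji: abelian_group "Mor C (D j) (D i)" using Obs by (simp add: Mor_abelian_group)
  have e: "flat k \<bullet> sharp k \<in> carrier (Mor C W W)" if "k \<in> I" for k
    using Comp_closed[of W "D k" W] W_Ob D_Ob flat_closed sharp_closed that by blast
  have ev: "(flat k \<bullet> sharp k) \<bullet> v \<in> carrier (Mor C (D j) W)" if "k \<in> I" for k
    using Comp_closed[of "D j" W W] Obs e[OF that] v by blast
  have "matrix_of C flat sharp T i k \<bullet> matrix_of C flat sharp S k j = u \<bullet> ((flat k \<bullet> sharp k) \<bullet> v)"
    if k: "k \<in> I" for k
  proof -
    note fk = flat_closed[OF k] and sk = sharp_closed[OF k] and Dk = D_Ob[OF k]
    have sv: "sharp k \<bullet> v \<in> carrier (Mor C (D j) (D k))"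
      using Comp_closed[of "D j" W "D k"] Obs Dk v sk by blast
    have "matrix_of C flat sharp T i k = u \<bullet> flat k"
      unfolding matrix_of_def u_def
      using Comp_assoc[of "D k" W W "D i" "flat k" T "sharp i"] Obs Dk fk T sharp_closed[OF i] by simp
    moreover have "(u \<bullet> flat k) \<bullet> (sharp k \<bullet> v) = u \<bullet> (flat k \<bullet> (sharp k \<bullet> v))"
      using Comp_assoc[of "D j" "D k" W "D i" "sharp k \<bullet> v" "flat k" u] Obs Dk fk sv u by simp
    moreover have "(flat k \<bullet> sharp k) \<bullet> v = flat k \<bullet> (sharp k \<bullet> v)"
      using Comp_assoc[of "D j" W "D k" W v "sharp k" "flat k"] Obs Dk fk sk v by simp
    ultimately show ?thesis by (simp add: matrix_of_def v_def)
  qed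
  then have "(\<Oplus>\<^bsub>Mor C (D j) (D i)\<^esub>k\<in>I. matrix_of C flat sharp T i k \<bullet> matrix_of C flat sharp S k j)
      = (\<Oplus>\<^bsub>Mor C (D j) (D i)\<^esub>k\<in>I. u \<bullet> ((flat k \<bullet> sharp k) \<bullet> v))"
    using Comp_closed[of "D j" W "D i"] Obs u ev by (intro ji.finsum_cong') auto
  also have "\<dots> = u \<bullet> (\<Oplus>\<^bsub>Mor C (D j) W\<^esub>k\<in>I. (flat k \<bullet> sharp k) \<bullet> v)"
    by (rule Comp_finsum_right[symmetric]) (use Obs u ev finite_I in auto)
  also have "(\<Oplus>\<^bsub>Mor C (D j) W\<^esub>k\<in>I. (flat k \<bullet> sharp k) \<bullet> v) = Ide C W \<bullet> v"
    unfolding sum_flat_sharp[symmetric]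
    by (rule Comp_finsum_left[symmetric]) (use Obs v e finite_I in auto)
  also have "\<dots> = v"
    using Comp_Ide_left[of "D j" W v] Obs v by simp
  also have "u \<bullet> v = sharp i \<bullet> (T \<bullet> v)"
    unfolding u_def by (rule Comp_assoc[of "D j" W W "D i"]) (use Obs T v sharp_closed[OF i] in auto)
  also have "T \<bullet> v = (T \<bullet> S) \<bullet> flat j"
    unfolding v_def by (rule Comp_assoc[of "D j" W W W, symmetric]) (use Obs T S flat_closed[OF j] in auto)
  finally show ?thesis by (simp add: matrix_of_def)
qed

lemma matrix_of_Ide:
  assumes "i \<in> I" "j \<in> I"
  shows "matrix_of C flat sharp (Ide C W) i j = delta C D i j"
  using assms W_Ob D_Ob flat_closed sharp_flat by (simp add: matrix_of_def Comp_Ide_left[of "D j"])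

end

section \<open>Paths\<close>

lemma path_hd_step:
  assumes "q \<in> paths C I D t k j"
  obtains r where "q = k # r"
  using assms unfolding paths_def by (cases q) auto

lemma paths_closed: "p \<in> paths C I D t i j \<Longrightarrow> i \<in> I \<and> j \<in> I"
  unfolding paths_def by auto

lemma Cons_Cons_in_paths:
  "i # k # r \<in> paths C I D t i' j \<longleftrightarrow>
     i' = i \<and> i \<in> I \<and> t i k \<noteq> \<zero>\<^bsub>Mor C (D k) (D i)\<^esub> \<and> k # r \<in> paths C I D t k j"
  unfolding paths_def last_index_def by (auto simp: less_Suc_eq_0_disj)

text \<open>Nonempty lists are sorted by whether there is a second vertex and, if so, which one.
  This serves twice: to prove path sets finite and to give the recursion for sums over them.\<close>

lemma paths_split:
  assumes "i \<in> I"
  shows "paths C I D t i j =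
    (if i = j then {[i]} else {}) \<union>
    (\<Union>k\<in>{k \<in> I. t i k \<noteq> \<zero>\<^bsub>Mor C (D k) (D i)\<^esub>}. (#) i ` paths C I D t k j)"
    (is "?L = ?R")
proof (rule Set.set_eqI)
  fix p
  show "p \<in> ?L \<longleftrightarrow> p \<in> ?R"
  proof (cases p)
    case Nil
    then show ?thesis by (auto simp: paths_def)
  next
    case (Cons a q)
    show ?thesis
    proof (cases q)
      case Nil
      have "[] \<notin> paths C I D t k j" for k by (simp add: paths_def)
      then show ?thesis
        using Nil Cons assms by (auto simp: paths_def last_index_def)
    next
      case (Cons b r)
      have "b # r \<in> paths C I D t k j \<Longrightarrow> k = b \<and> b \<in> I" for k
        by (auto simp: paths_def)
      then show ?thesis
        using Cons \<open>p = a # q\<close> assms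
        by (auto simp: Cons_Cons_in_paths)
    qed
  qed
qed

text \<open>Induction proceeds downwards from the maximal elements. The measure counts the elements
  above \<open>i\<close>: passing to a strictly larger \<open>k\<close>, transitivity gives
  inclusion of the upper sets, and antisymmetry removes \<open>i\<close> itself.\<close>

lemma partial_order_on_finite_wf:
  assumes "finite I" "partial_order_on I P"
  shows "wf {(k, i). i \<in> I \<and> k \<in> I \<and> k \<noteq> i \<and> (i, k) \<in> P}"
proof -
  have "{(k, i). i \<in> I \<and> k \<in> I \<and> k \<noteq> i \<and> (i, k) \<in> P} \<subseteq> measure (\<lambda>i. card {k \<in> I. (i, k) \<in> P})"
  proof clarsimp
    fix k i assume ik: "i \<in> I" "k \<in> I" "k \<noteq> i" "(i, k) \<in> P"
    have "{l \<in> I. (k, l) \<in> P} \<subset> {l \<in> I. (i, l) \<in> P}"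
      using assms(2) ik
      unfolding partial_order_on_def preorder_on_def antisym_def trans_def refl_on_def by blast
    then show "card {l \<in> I. (k, l) \<in> P} < card {l \<in> I. (i, l) \<in> P}"
      using assms(1) by (intro psubset_card_mono) auto
  qed
  then show ?thesis using wf_measure wf_subset by blast
qed

section \<open>The inverse matrix\<close>

text \<open>No automorphism appears here: the recursion concerns any matrix of morphisms with
  invertible diagonal, and a column \<open>M\<close> of a right inverse enters the lemmas as a
  variable.\<close>

locale diagonal_iso_matrix = preadditive_category C
  for C :: "('o, 'm) preadd" (structure) +
  fixes I :: "'i set" and D :: "'i \<Rightarrow> 'o" and A :: "'i \<Rightarrow> 'i \<Rightarrow> 'm"
  assumes finite_index: "finite I"
    and Ob_D: "a \<in> I \<Longrightarrow> D a \<in> Ob C"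
    and A_closed: "a \<in> I \<Longrightarrow> b \<in> I \<Longrightarrow> A a b \<in> carrier (Mor C (D b) (D a))"
    and iso_diagonal: "a \<in> I \<Longrightarrow> iso_mor C (D a) (D a) (A a a)"
begin

definition diag_inv :: "'i \<Rightarrow> 'm" where
  "diag_inv a = inv_mor C (D a) (D a) (A a a)"

text \<open>The endpoints are arguments because they name the hom-group in which the sign
  acts.\<close>

definition signed_path_product :: "'i \<Rightarrow> 'i \<Rightarrow> 'i list \<Rightarrow> 'm" where
  "signed_path_product i j p =
     [((- 1 :: int) ^ last_index p)] \<cdot>\<^bsub>Mor C (D j) (D i)\<^esub> path_product C D A p"

abbreviation "offdiag \<equiv> off_diagonal C D A"

lemma diag_inv:
  assumes "a \<in> I"
  shows "diag_inv a \<in> carrier (Mor C (D a) (D a))" "diag_inv a \<bullet> A a a = Ide C (D a)"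
  using inverse_pair_inv_mor[OF Ob_D Ob_D iso_diagonal] assms
  unfolding inverse_pair_def diag_inv_def by blast+

lemma diag_inv_step_closed:
  assumes "i \<in> I" "k \<in> I" "Y \<in> Ob C" "x \<in> carrier (Mor C Y (D k))"
  shows "diag_inv i \<bullet> A i k \<bullet> x \<in> carrier (Mor C Y (D i))"
  using assms Ob_D diag_inv A_closed
  by (intro Comp_closed[of Y "D i" "D i"] Comp_closed[of Y "D k" "D i"]) auto

lemma path_product_closed:
  assumes "p \<noteq> []" "set p \<subseteq> I"
  shows "path_product C D A p \<in> carrier (Mor C (D (last p)) (D (hd p)))"
  using assms
proof (induction p rule: induct_list012)
  case (2 a)
  then show ?case using diag_inv by (simp add: diag_inv_def)
next
  case (3 a b p)
  moreover have "last (b # p) \<in> I"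
    using "3.prems"(2) last_in_set[of "b # p"] by auto
  ultimately show ?case
    using diag_inv_step_closed[of a b "D (last (b # p))"] Ob_D
    by (simp add: diag_inv_def)
qed simp

lemma path_product_paths_closed:
  assumes "p \<in> paths C I D t i j"
  shows "path_product C D A p \<in> carrier (Mor C (D j) (D i))"
  using assms path_product_closed[of p] unfolding paths_def by auto

lemma signed_path_product_closed:
  assumes "p \<in> paths C I D t i j"
  shows "signed_path_product i j p \<in> carrier (Mor C (D j) (D i))"
proof -
  interpret abelian_group "Mor C (D j) (D i)"
    using paths_closed[OF assms] Ob_D by (simp add: Mor_abelian_group)
  show ?thesis
    unfolding signed_path_product_def
    using path_product_paths_closed[OF assms] by simp
qed

text \<open>A new first vertex brings two factors in front and one more sign; the old sign passes
  through these factors by bilinearity.\<close>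

lemma signed_path_product_Cons:
  assumes "i \<in> I" "q \<in> paths C I D t k j"
  shows "signed_path_product i j (i # q) =
    \<ominus>\<^bsub>Mor C (D j) (D i)\<^esub> (diag_inv i \<bullet> A i k \<bullet> signed_path_product k j q)"
proof -
  obtain r where q: "q = k # r" using path_hd_step[OF assms(2)] .
  have kj: "k \<in> I" "j \<in> I" using paths_closed[OF assms(2)] by auto
  note Obs = Ob_D[OF assms(1)] Ob_D[OF kj(1)] Ob_D[OF kj(2)]
  interpret ji: abelian_group "Mor C (D j) (D i)" using Obs by (simp add: Mor_abelian_group)
  note pc = path_product_paths_closed[OF assms(2)]
  note Apc = Comp_closed[OF Obs(3,2,1) pc A_closed[OF assms(1) kj(1)]]
  have "diag_inv i \<bullet> A i k \<bullet> signed_path_product k j q =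
      [((- 1 :: int) ^ last_index q)] \<cdot>\<^bsub>Mor C (D j) (D i)\<^esub> (diag_inv i \<bullet> A i k \<bullet> path_product C D A q)"
    unfolding signed_path_product_def
    using Comp_sign_right[OF Obs(3,2,1) pc A_closed[OF assms(1) kj(1)]]
      Comp_sign_right[OF Obs(3,1,1) Apc diag_inv(1)[OF assms(1)]] by simp
  moreover have "last_index (i # q) = Suc (last_index q)"
    by (simp add: last_index_def q)
  moreover have "path_product C D A (i # q) = diag_inv i \<bullet> A i k \<bullet> path_product C D A q"
    by (simp add: q diag_inv_def)
  ultimately show ?thesis
    using ji.add_pow_minus_one_Suc diag_inv_step_closed[OF assms(1) kj(1) Obs(3) pc]
    by (simp add: signed_path_product_def del: power_Suc)
qed

text \<open>The path sum obeys the same recursion as a column of the inverse. The sum is grouped by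
  second vertex; within each group the two leading factors and the new sign are common, and
  finiteness of the group allows them to be taken out.\<close>

lemma paths_sum_split:
  assumes i: "i \<in> I" and j: "j \<in> I"
    and N: "N = {k \<in> I. offdiag i k \<noteq> \<zero>\<^bsub>Mor C (D k) (D i)\<^esub>}"
    and fin: "\<And>k. k \<in> N \<Longrightarrow> finite (paths C I D offdiag k j)"
  shows "(\<Oplus>\<^bsub>Mor C (D j) (D i)\<^esub>p \<in> paths C I D offdiag i j. signed_path_product i j p) =
    diag_inv i \<bullet> delta C D i j \<oplus>\<^bsub>Mor C (D j) (D i)\<^esub>
    (\<Oplus>\<^bsub>Mor C (D j) (D i)\<^esub>k\<in>N. \<ominus>\<^bsub>Mor C (D j) (D i)\<^esub> (diag_inv i \<bullet> A i k \<bullet>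
       (\<Oplus>\<^bsub>Mor C (D j) (D k)\<^esub>p \<in> paths C I D offdiag k j. signed_path_product k j p)))"
proof -
  let ?G = "Mor C (D j) (D i)"
  let ?P = "\<lambda>k. paths C I D offdiag k j" and ?v = "\<lambda>k. signed_path_product k j"
  let ?s = "\<lambda>k. \<Oplus>\<^bsub>Mor C (D j) (D k)\<^esub>p \<in> ?P k. ?v k p"
  \<comment> \<open>Negation as left composition with \<open>-1\<close>, so that it moves out of sums with the other factors.\<close>
  let ?minus = "\<ominus>\<^bsub>Mor C (D i) (D i)\<^esub> Ide C (D i)"
  interpret ji: abelian_group ?G using Ob_D i j by (simp add: Mor_abelian_group)
  let ?w = "signed_path_product i j"
  let ?B = "if i = j then {[i]} else {}"
  let ?U = "\<Union>k\<in>N. (#) i ` ?P k"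
  have split: "paths C I D offdiag i j = ?B \<union> ?U"
    unfolding N by (rule paths_split[OF i])
  have finN: "finite N" unfolding N using finite_index by simp
  have w: "?w \<in> paths C I D offdiag i j \<rightarrow> carrier ?G"
    using signed_path_product_closed by blast
  \<comment> \<open>Separates \<open>[i]\<close> from the lists in \<open>?U\<close>, which have at
    least two vertices.\<close>
  have nonempty: "[] \<notin> ?P k" for k
    by (simp add: paths_def)
  have "(\<Oplus>\<^bsub>?G\<^esub>p \<in> paths C I D offdiag i j. ?w p) =
      (\<Oplus>\<^bsub>?G\<^esub>p \<in> ?B. ?w p) \<oplus>\<^bsub>?G\<^esub> (\<Oplus>\<^bsub>?G\<^esub>p \<in> ?U. ?w p)"
    unfolding split
    by (rule ji.finsum_Un_disjoint) (use w split finN fin nonempty in auto)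
  also have "(\<Oplus>\<^bsub>?G\<^esub>p \<in> ?B. ?w p) = diag_inv i \<bullet> delta C D i j"
  proof (cases "i = j")
    case True
    have "[i] \<in> paths C I D offdiag i j"
      using split True by auto
    then have "(\<Oplus>\<^bsub>?G\<^esub>p \<in> {[i]}. ?w p) = ?w [i]"
      using ji.finsum_insert[of "{}" "[i]" ?w] signed_path_product_closed by simp
    moreover have "?w [i] = diag_inv i"
      using ji.add.int_pow_1 diag_inv(1)[OF i] True
      by (simp add: signed_path_product_def last_index_def diag_inv_def)
    ultimately show ?thesis
      using True diag_inv(1)[OF i] Ob_D[OF i] by (simp add: delta_def Comp_Ide_right)
  next
    case False
    then show ?thesis
      using Comp_zero_right[OF Ob_D[OF j] Ob_D[OF i] Ob_D[OF i] diag_inv(1)[OF i]]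
      by (simp add: delta_def)
  qed
  also have "(\<Oplus>\<^bsub>?G\<^esub>p \<in> ?U. ?w p) =
      (\<Oplus>\<^bsub>?G\<^esub>k\<in>N. \<Oplus>\<^bsub>?G\<^esub>p \<in> (#) i ` ?P k. ?w p)"
  proof (rule ji.add.finprod_UN_disjoint)
    \<comment> \<open>Lists in \<open>?P k\<close> start with \<open>k\<close>, so different second
      vertices give disjoint groups.\<close>
    show "pairwise (\<lambda>k l. disjnt ((#) i ` ?P k) ((#) i ` ?P l)) N"
      by (auto simp: pairwise_def disjnt_def paths_def)
    show "?w p \<in> carrier ?G" if "k \<in> N" "p \<in> (#) i ` ?P k" for k p
      using w split that by blast
  qed (use finN fin in auto)
  also have "\<dots> = (\<Oplus>\<^bsub>?G\<^esub>k\<in>N. \<ominus>\<^bsub>?G\<^esub> (diag_inv i \<bullet> A i k \<bullet> ?s k))"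
  proof (rule ji.finsum_cong'[OF refl])
    have kI: "k \<in> I" if "k \<in> N" for k using that N by simp
    have sum_closed: "?s k \<in> carrier (Mor C (D j) (D k))" if "k \<in> N" for k
    proof -
      interpret jk: abelian_group "Mor C (D j) (D k)"
        using Ob_D kI[OF that] j by (simp add: Mor_abelian_group)
      show ?thesis using signed_path_product_closed by (intro jk.finsum_closed) blast
    qed
    show "(\<lambda>k. \<ominus>\<^bsub>?G\<^esub> (diag_inv i \<bullet> A i k \<bullet> ?s k)) \<in> N \<rightarrow> carrier ?G"
      using diag_inv_step_closed sum_closed kI i Ob_D[OF j] by auto
    fix k assume kN: "k \<in> N"
    note k = kI[OF kN]
    note Obs = Ob_D[OF i] Ob_D[OF k] Ob_D[OF j]
    have wCons: "?w (i # q) \<in> carrier ?G" if "q \<in> ?P k" for q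
      using w split kN that by blast
    have closed: "A i k \<bullet> ?v k q \<in> carrier ?G" if "q \<in> ?P k" for q
      using Comp_closed[OF Obs(3,2,1)] A_closed i k signed_path_product_closed that by blast
    have neg: "\<ominus>\<^bsub>?G\<^esub> x = ?minus \<bullet> x"
      if "x \<in> carrier ?G" for x
      using preadditive_category.Comp_minus_right[OF preadditive_opposite,
          of "D i" "D i" "D j" "Ide C (D i)" x] Obs that
      by (simp add: Ide_closed Comp_Ide_left)
    interpret ii: abelian_group "Mor C (D i) (D i)" using Obs by (simp add: Mor_abelian_group)
    have "(\<Oplus>\<^bsub>?G\<^esub>p \<in> (#) i ` ?P k. ?w p) =
        (\<Oplus>\<^bsub>?G\<^esub>q \<in> ?P k. ?w (i # q))"
      by (rule ji.finsum_reindex) (use wCons in auto)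
    also have "\<dots> = (\<Oplus>\<^bsub>?G\<^esub>q \<in> ?P k.
        ?minus \<bullet> diag_inv i \<bullet> A i k \<bullet> ?v k q)"
    proof (rule ji.finsum_cong'[OF refl])
      have eq: "?w (i # q) = ?minus \<bullet> diag_inv i \<bullet> A i k \<bullet> ?v k q"
        if "q \<in> ?P k" for q
        using signed_path_product_Cons[OF i that] neg diag_inv_step_closed[OF i k Obs(3)]
          signed_path_product_closed[OF that] by simp
      then show "?w (i # q) = ?minus \<bullet> diag_inv i \<bullet> A i k \<bullet> ?v k q"
        if "q \<in> ?P k" for q using that .
      show "(\<lambda>q. ?minus \<bullet> diag_inv i \<bullet> A i k \<bullet> ?v k q)
          \<in> ?P k \<rightarrow> carrier ?G" using eq wCons by simp
    qed
    also have "\<dots> = ?minus \<bullet>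
        (\<Oplus>\<^bsub>?G\<^esub>q \<in> ?P k. diag_inv i \<bullet> A i k \<bullet> ?v k q)"
      by (rule Comp_finsum_right[symmetric])
        (use Obs fin[OF kN] Ide_closed diag_inv_step_closed[OF i k] signed_path_product_closed in auto)
    also have "(\<Oplus>\<^bsub>?G\<^esub>q \<in> ?P k. diag_inv i \<bullet> A i k \<bullet> ?v k q) =
        diag_inv i \<bullet> (\<Oplus>\<^bsub>?G\<^esub>q \<in> ?P k. A i k \<bullet> ?v k q)"
      by (rule Comp_finsum_right[symmetric])
        (use Obs fin[OF kN] diag_inv[OF i] closed in auto)
    also have "(\<Oplus>\<^bsub>?G\<^esub>q \<in> ?P k. A i k \<bullet> ?v k q) =
        A i k \<bullet> ?s k"
      by (rule Comp_finsum_right[symmetric])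
        (use Obs fin[OF kN] A_closed[OF i k] signed_path_product_closed in auto)
    also have "?minus \<bullet> diag_inv i \<bullet> A i k \<bullet> ?s k = \<ominus>\<^bsub>?G\<^esub> (diag_inv i \<bullet> A i k \<bullet> ?s k)"
      using neg diag_inv_step_closed[OF i k Obs(3) sum_closed[OF kN]] by simp
    finally show "(\<Oplus>\<^bsub>?G\<^esub>p \<in> (#) i ` ?P k. ?w p) =
        \<ominus>\<^bsub>?G\<^esub> (diag_inv i \<bullet> A i k \<bullet> ?s k)" .
  qed
  finally show ?thesis .
qed

text \<open>After composition with \<open>diag_inv i\<close> on the left, the \<open>i\<close>-th
  term of the row equation is \<open>M i\<close>. Terms outside \<open>insert i N\<close> vanish
  with their entry of \<open>A\<close>, and the remaining sum over \<open>N\<close> is cancelled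
  against its termwise negative.\<close>

lemma right_inverse_row:
  assumes i: "i \<in> I" and j: "j \<in> I"
    and N: "N = {k \<in> I. offdiag i k \<noteq> \<zero>\<^bsub>Mor C (D k) (D i)\<^esub>}"
    and M: "\<And>k. k \<in> I \<Longrightarrow> M k \<in> carrier (Mor C (D j) (D k))"
    and AM: "(\<Oplus>\<^bsub>Mor C (D j) (D i)\<^esub>k\<in>I. A i k \<bullet> M k) = delta C D i j"
  shows "M i = diag_inv i \<bullet> delta C D i j \<oplus>\<^bsub>Mor C (D j) (D i)\<^esub>
    (\<Oplus>\<^bsub>Mor C (D j) (D i)\<^esub>k\<in>N. \<ominus>\<^bsub>Mor C (D j) (D i)\<^esub> (diag_inv i \<bullet> A i k \<bullet> M k))"
proof -
  let ?G = "Mor C (D j) (D i)"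
  interpret ji: abelian_group ?G using Ob_D i j by (simp add: Mor_abelian_group)
  let ?x = "\<lambda>k. diag_inv i \<bullet> A i k \<bullet> M k"
  have x: "?x k \<in> carrier ?G" if "k \<in> I" for k
    using diag_inv_step_closed[OF i that Ob_D[OF j] M[OF that]] .
  have NI: "N \<subseteq> I" and iN: "i \<notin> N" and finN: "finite N"
    using N finite_index by (auto simp: off_diagonal_def)
  have xs: "?x \<in> N \<rightarrow> carrier ?G" using x NI by auto
  have xi: "?x i = M i"
    using Comp_assoc[of "D j" "D i" "D i" "D i" "M i" "A i i" "diag_inv i"] Ob_D i j M A_closed
      diag_inv[OF i] Comp_Ide_left[of "D j" "D i" "M i"] by simp
  have zero: "?x k = \<zero>\<^bsub>?G\<^esub>" if "k \<in> I - insert i N" for k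
  proof -
    have "A i k = \<zero>\<^bsub>Mor C (D k) (D i)\<^esub>"
      using that N by (auto simp: off_diagonal_def)
    moreover have "\<zero>\<^bsub>Mor C (D k) (D i)\<^esub> \<bullet> M k = \<zero>\<^bsub>?G\<^esub>"
      using preadditive_category.Comp_zero_right[OF preadditive_opposite, of "D i" "D k" "D j" "M k"]
        Ob_D i j M that by simp
    ultimately show ?thesis
      using Comp_zero_right[of "D j" "D i" "D i" "diag_inv i"] Ob_D i j diag_inv by simp
  qed
  have "diag_inv i \<bullet> delta C D i j = (\<Oplus>\<^bsub>?G\<^esub>k\<in>I. ?x k)"
    unfolding AM[symmetric]
    by (rule Comp_finsum_right)
      (use Ob_D i j diag_inv finite_index Comp_closed[OF Ob_D Ob_D Ob_D M A_closed] in auto)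
  also have "\<dots> = (\<Oplus>\<^bsub>?G\<^esub>k\<in>insert i N. ?x k)"
    by (rule ji.add.finprod_mono_neutral_cong_right) (use finite_index NI i zero x in auto)
  also have "\<dots> = M i \<oplus>\<^bsub>?G\<^esub> (\<Oplus>\<^bsub>?G\<^esub>k\<in>N. ?x k)"
    using ji.finsum_insert[OF finN iN, of ?x] xs x[OF i] xi by simp
  finally have eq: "diag_inv i \<bullet> delta C D i j =
      M i \<oplus>\<^bsub>?G\<^esub> (\<Oplus>\<^bsub>?G\<^esub>k\<in>N. ?x k)" .
  have "(\<Oplus>\<^bsub>?G\<^esub>k\<in>N. ?x k) \<oplus>\<^bsub>?G\<^esub>
      (\<Oplus>\<^bsub>?G\<^esub>k\<in>N. \<ominus>\<^bsub>?G\<^esub> ?x k) =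
      (\<Oplus>\<^bsub>?G\<^esub>k\<in>N. ?x k \<oplus>\<^bsub>?G\<^esub> (\<ominus>\<^bsub>?G\<^esub> ?x k))"
    by (rule ji.finsum_addf[symmetric]) (use xs in auto)
  also have "\<dots> = \<zero>\<^bsub>?G\<^esub>"
    by (rule ji.add.finprod_one_eqI) (use xs ji.r_neg in auto)
  finally have cancel: "(\<Oplus>\<^bsub>?G\<^esub>k\<in>N. ?x k) \<oplus>\<^bsub>?G\<^esub>
      (\<Oplus>\<^bsub>?G\<^esub>k\<in>N. \<ominus>\<^bsub>?G\<^esub> ?x k) = \<zero>\<^bsub>?G\<^esub>" .
  have "(\<Oplus>\<^bsub>?G\<^esub>k\<in>N. ?x k) \<in> carrier ?G"
    "(\<Oplus>\<^bsub>?G\<^esub>k\<in>N. \<ominus>\<^bsub>?G\<^esub> ?x k) \<in> carrier ?G"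
    using xs by (auto intro!: ji.finsum_closed)
  then show ?thesis
    unfolding eq using M[OF i] by (simp add: ji.a_assoc cancel)
qed

text \<open>Both sides satisfy one recursion, in which row \<open>i\<close> depends only on rows
  strictly above \<open>i\<close>; well-founded induction makes them equal.\<close>

lemma right_inverse_eq_paths_sum:
  assumes acyclic: "acyclic_on I (support C I D A)"
    and j: "j \<in> I"
    and M: "\<And>k. k \<in> I \<Longrightarrow> M k \<in> carrier (Mor C (D j) (D k))"
    and AM: "\<And>i. i \<in> I \<Longrightarrow> (\<Oplus>\<^bsub>Mor C (D j) (D i)\<^esub>k\<in>I. A i k \<bullet> M k) = delta C D i j"
    and i: "i \<in> I"
  shows "M i = (\<Oplus>\<^bsub>Mor C (D j) (D i)\<^esub>p \<in> paths C I D offdiag i j. signed_path_product i j p)"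
proof -
  obtain P where P: "partial_order_on I P" "support C I D A \<subseteq> P"
    using acyclic unfolding acyclic_on_def by blast
  \<comment> \<open>Finiteness is part of the induction claim because splitting the path sum at
    \<open>i\<close> requires it for every \<open>k\<close> in \<open>N\<close>.\<close>
  have "finite (paths C I D offdiag i j) \<and>
      M i = (\<Oplus>\<^bsub>Mor C (D j) (D i)\<^esub>p \<in> paths C I D offdiag i j. signed_path_product i j p)"
    using i
  proof (induction i rule: wf_induct_rule[OF partial_order_on_finite_wf[OF finite_index P(1)]])
    case (1 i)
    define N where "N = {k \<in> I. offdiag i k \<noteq> \<zero>\<^bsub>Mor C (D k) (D i)\<^esub>}"
    have IH: "finite (paths C I D offdiag k j)"
      "M k = (\<Oplus>\<^bsub>Mor C (D j) (D k)\<^esub>p \<in> paths C I D offdiag k j. signed_path_product k j p)"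
      if "k \<in> N" for k
    proof -
      \<comment> \<open>A nonzero off-diagonal entry lies in the support, hence in \<open>P\<close>,
        so \<open>k\<close> is strictly above \<open>i\<close> and the induction hypothesis applies
        to it.\<close>
      have "k \<in> I" "k \<noteq> i" "(i, k) \<in> support C I D A"
        using that 1(2) by (auto simp: N_def off_diagonal_def support_def split: if_splits)
      then show "finite (paths C I D offdiag k j)"
        "M k = (\<Oplus>\<^bsub>Mor C (D j) (D k)\<^esub>p \<in> paths C I D offdiag k j. signed_path_product k j p)"
        using 1 P(2) by auto
    qed
    interpret ji: abelian_group "Mor C (D j) (D i)" using Ob_D 1(2) j by (simp add: Mor_abelian_group)
    have NI: "N \<subseteq> I" by (auto simp: N_def)
    have "finite (paths C I D offdiag i j)"
      using paths_split[OF 1(2), of C D offdiag j] IH(1) finite_index by (auto simp: N_def)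
    moreover have "(\<Oplus>\<^bsub>Mor C (D j) (D i)\<^esub>k\<in>N. \<ominus>\<^bsub>Mor C (D j) (D i)\<^esub> (diag_inv i \<bullet> A i k \<bullet>
          (\<Oplus>\<^bsub>Mor C (D j) (D k)\<^esub>p \<in> paths C I D offdiag k j. signed_path_product k j p))) =
        (\<Oplus>\<^bsub>Mor C (D j) (D i)\<^esub>k\<in>N. \<ominus>\<^bsub>Mor C (D j) (D i)\<^esub> (diag_inv i \<bullet> A i k \<bullet> M k))"
      by (rule ji.finsum_cong')
        (use NI IH(2) diag_inv_step_closed[OF 1(2) _ Ob_D[OF j] M] in auto)
    ultimately show ?case
      using right_inverse_row[of i j N M, OF 1(2) j N_def M AM[OF 1(2)]]
        paths_sum_split[OF 1(2) j N_def IH(1)] by simp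
  qed
  then show ?thesis by simp
qed

end

text \<open>The exponent is the number m of steps, where the English sentence has m + 1: for a
  diagonal matrix only the path \<open>[i]\<close> remains, and the inverse has entry
  \<open>inv_mor C (D i) (D i) (A i i)\<close> with a plus sign. Invertibility of the diagonal
  entries, presupposed by A[p], is assumed because it does not follow from that of \<open>T\<close>:
  if RS = 1 but SR is not 1, the triangular matrix with rows (S, 1 - SR) and (0, R) has the inverse
  with rows (R, 0) and (1 - SR, S).\<close>

theorem theorem6p6p6:
  fixes C :: "('o, 'm) preadd" and W :: 'o and T :: 'm
    and I :: "'i set" and D :: "'i \<Rightarrow> 'o" and \<omega> flat sharp :: "'i \<Rightarrow> 'm"
    and A t :: "'i \<Rightarrow> 'i \<Rightarrow> 'm" and i j :: 'i
  assumes "preadditive_category C"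
    and "iso_mor C W W T"
    and "finite I"
    and "structure_with_dual C I D W \<omega> flat sharp"
    and "A = matrix_of C flat sharp T"
    and "acyclic_on I (support C I D A)"
    and "\<forall>a\<in>I. iso_mor C (D a) (D a) (A a a)"
    and "t = off_diagonal C D A"
    and "i \<in> I" and "j \<in> I"
  shows "matrix_of C flat sharp (inv_mor C W W T) i j =
    (\<Oplus>\<^bsub>Mor C (D j) (D i)\<^esub>p \<in> paths C I D t i j.
       [((- 1 :: int) ^ last_index p)] \<cdot>\<^bsub>Mor C (D j) (D i)\<^esub> path_product C D A p)"
proof -
  interpret preadditive_category C by fact
  interpret finite_biproduct C I D W flat sharp
    using assms(3,4) by (intro structure_with_dual_biproduct)
  have "inverse_pair C W W T (inv_mor C W W T)"
    using inverse_pair_inv_mor W_Ob assms(2) by blast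
  then have T: "T \<in> carrier (Mor C W W)" and S: "inv_mor C W W T \<in> carrier (Mor C W W)"
    and eq: "T \<bullet>\<^bsub>C\<^esub> inv_mor C W W T = Ide C W"
    unfolding inverse_pair_def by blast+
  interpret diagonal_iso_matrix C I D A
    using assms(3,5,7) D_Ob matrix_of_closed[OF T] by unfold_locales auto
  have "(\<Oplus>\<^bsub>Mor C (D j) (D i)\<^esub>k\<in>I. A i k \<bullet>\<^bsub>C\<^esub> matrix_of C flat sharp (inv_mor C W W T) k j) =
      delta C D i j" if "i \<in> I" for i
    unfolding assms(5) matrix_of_mult[OF T S that assms(10)] eq
    by (rule matrix_of_Ide[OF that assms(10)])
  then show ?thesis
    using right_inverse_eq_paths_sum[OF assms(6) assms(10), of
        "\<lambda>k. matrix_of C flat sharp (inv_mor C W W T) k j" i]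
      matrix_of_closed[OF S] assms(8-10)
    by (simp add: signed_path_product_def)
qed

end
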